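(* Let $G$ be a graph of genus $g$ with an orientation $\mathfrak o$, $T$ a spanning tree of $G$, $t\ge2$, and $\alpha\in H_1(G,\mathbb Z/t\mathbb Z)$. Then for every length $l$, $$N_t(\alpha,l)=\frac{1}{t^g}\sum_{\gamma\in M_t(\mathbf E_{\mathfrak o}^c(T))}\epsilon_t^{-\langle\gamma,\alpha\rangle}\operatorname{trace}\left(W_{1,\gamma}^l\right),\qquad \widetilde N_t(\alpha,l)=\frac{1}{t^g}\sum_{\gamma\in M_t(\mathbf E_{\mathfrak o}^c(T))}\epsilon_t^{-\langle\gamma,\alpha\rangle}\operatorname{trace}\left(A_\gamma^l\right).$$
   Context: A graph is connected and finite, loops and multiple edges allowed, vertices $v_1,\dots,v_n$, edges $e_1,\dots,e_m$, genus $g=m-n+1$. Each edge gives two mutually inverse oriented edges; $\mathbf e(0),\mathbf e(1)$ are initial/terminal vertex. An orientation $\mathfrak o$ picks a positively oriented $\mathbf e_k$ for each $e_k$; $\mathbf E_{\mathfrak o}(G)=\{\mathbf e_1,\dots,\mathbf e_m\}$, $\mathbf E(G)$ is the set of all $2m$ oriented edges, $\mathbf E^c_{\mathfrak o}(T)$ the positively oriented edges not in $T$. A closed walk of length $l$ is $\mathbf a_1\cdots\mathbf a_l$ with $\mathbf a_{i+1}(0)=\mathbf a_i(1)$, $\mathbf a_l(1)=\mathbf a_1(0)$; a circuit is a closed walk with no backtrack ($\mathbf a_{i+1}\ne\mathbf a_i^{-1}$) and no tail ($\mathbf a_l\ne\mathbf a_1^{-1}$), counted as sequences. $C_1(G,R)$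 is the free $R$-module on $\mathbf E_{\mathfrak o}(G)$ with $1\cdot\mathbf e^{-1}=-1\cdot\mathbf e$; $\langle\sum a_k\mathbf e_k,\sum b_k\mathbf e_k\rangle=\sum a_kb_k$. $H_1(G,R)$ consists of $\sum a_k\mathbf e_k$ with $\sum_{\mathbf e_k(0)=v}a_k=\sum_{\mathbf e_k(1)=v}a_k$ for every vertex $v$. $M_t(\mathbf F)\subseteq C_1(G,\mathbb Z/t\mathbb Z)$ is the submodule of elements supported on $\mathbf F$. The abelianization of a walk $C=\mathbf a_1\cdots\mathbf a_l$ is $C^{ab}=\sum\mathbf a_i\in C_1(G,\mathbb Z)$, and $C^{ab}_{[t]}$ its reduction mod $t$. $N_t(\alpha,l)$ (resp. $\widetilde N_t(\alpha,l)$) is the number of circuits (resp. closed walks) $C$ of length $l$ with $C^{ab}_{[t]}=\alpha$. $\epsilon_t=\exp(2\pi i/t)$; for $\gamma\in C_1(G,\mathbb Z/t\mathbb Z)$, $\chi_\gamma(\mathbf e)=\epsilon_t^{\langle\gamma,1\cdot\mathbf e\rangle}$. $A_\gamma$: $n\times n$, $(i,j)$ entry $\sum\chi_\gamma(\mathbf e)$ over $\mathbf e\in\mathbf E(G)$ from $v_i$ to $v_j$. $\mathbf e$ feeds into $\mathbf e'$ if $\mathbf e'\ne\mathbf e^{-1}$ and $\mathbf e(1)=\mathbf e'(0)$; $W_{1,\gamma}$: $2m\times 2m$ indexed by $\mathbf E(G)$, $(\mathbf e,\mathbf e')$ entry $\chi_\gamma(\mathbf e)$ if $\mathbf e$ feeds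 into $\mathbf e'$, else $0$. *)

theory Defs
  imports
    "Graph_Theory.Graph_Theory"
    "Jordan_Normal_Form.Matrix"
    "HOL-Algebra.IntRing"
    "HOL-Number_Theory.Residues"
begin

text \<open>
  A graph is given by its vertices and its oriented edges: the arcs of a digraph together
  with a fixed-point-free involution \<open>arev\<close> on the arcs which exchanges tail and head.  An edge is
  a pair \<open>{a, arev a}\<close>, so multiple edges and loops are allowed, and each loop carries two distinct
  oriented edges.
\<close>

locale multigraph = fin_digraph G + bidirected_digraph G arev
  for G :: "('v, 'a) pre_digraph" and arev :: "'a \<Rightarrow> 'a" +
  assumes connected: "connected G"

definition edge_set :: "('v, 'a) pre_digraph \<Rightarrow> ('a \<Rightarrow> 'a) \<Rightarrow> 'a set set" where
  "edge_set G arev = (\<lambda>a. {a, arev a}) ` arcs G"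

text \<open>This is \<open>m - n + 1\<close>; the truncated subtraction is harmless, since \<open>n \<le> m + 1\<close> for connected
  graphs.\<close>

definition genus :: "('v, 'a) pre_digraph \<Rightarrow> ('a \<Rightarrow> 'a) \<Rightarrow> nat" where
  "genus G arev = card (edge_set G arev) + 1 - card (verts G)"

definition orientation :: "('v, 'a) pre_digraph \<Rightarrow> ('a \<Rightarrow> 'a) \<Rightarrow> 'a set \<Rightarrow> bool" where
  "orientation G arev pos \<longleftrightarrow> pos \<subseteq> arcs G \<and> (\<forall>E \<in> edge_set G arev. \<exists>!a. a \<in> E \<and> a \<in> pos)"

subsection \<open>Closed walks, circuits, spanning trees\<close>

definition closed_walk :: "('v, 'a) pre_digraph \<Rightarrow> 'a list \<Rightarrow> bool" where
  "closed_walk G p \<longleftrightarrow> p \<noteq> [] \<and> (\<exists>u. pre_digraph.awalk G u p u)"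

definition circuit :: "('v, 'a) pre_digraph \<Rightarrow> ('a \<Rightarrow> 'a) \<Rightarrow> 'a list \<Rightarrow> bool" where
  "circuit G arev p \<longleftrightarrow> closed_walk G p
     \<and> (\<forall>i. Suc i < length p \<longrightarrow> p ! Suc i \<noteq> arev (p ! i))
     \<and> last p \<noteq> arev (hd p)"

text \<open>
  The predicate \<open>spanning_tree\<close> of the graph library is not suitable here: it forbids directed
  cycles, and hence already the closed walk \<open>a, arev a\<close>.
\<close>

definition is_spanning_tree ::
    "('v, 'a) pre_digraph \<Rightarrow> ('a \<Rightarrow> 'a) \<Rightarrow> ('v, 'a) pre_digraph \<Rightarrow> bool" where
  "is_spanning_tree G arev T \<longleftrightarrow> spanning T G \<and> arev ` arcs T \<subseteq> arcs T
     \<and> connected T \<and> \<not> (\<exists>p. circuit T arev p)"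

text \<open>The positively oriented edges outside \<open>T\<close>.\<close>

definition cotree :: "'a set \<Rightarrow> ('v, 'a) pre_digraph \<Rightarrow> 'a set" where
  "cotree pos T = pos - arcs T"

subsection \<open>Chains and homology\<close>

text \<open>
  A chain is the (extensional) family of its coefficients on the positively oriented edges.
  The coefficient rings are \<open>int_ring\<close> and \<open>residue_ring t\<close>, whose elements are the
  representatives \<open>0, \<dots>, t - 1\<close>.
\<close>

definition C1 :: "'a set \<Rightarrow> ('r, 'm) ring_scheme \<Rightarrow> ('a \<Rightarrow> 'r) set" where
  "C1 pos R = pos \<rightarrow>\<^sub>E carrier R"

text \<open>The chain \<open>1 \<cdot> a\<close> of an arbitrary oriented edge \<open>a\<close>.\<close>

definition edge_chain :: "('a \<Rightarrow> 'a) \<Rightarrow> 'a set \<Rightarrow> ('r, 'm) ring_scheme \<Rightarrow> 'a \<Rightarrow> ('a \<Rightarrow> 'r)" where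
  "edge_chain arev pos R a =
     (\<lambda>e\<in>pos. if e = a then \<one>\<^bsub>R\<^esub> else if e = arev a then \<ominus>\<^bsub>R\<^esub> \<one>\<^bsub>R\<^esub> else \<zero>\<^bsub>R\<^esub>)"

definition chain_inner ::
    "'a set \<Rightarrow> ('r, 'm) ring_scheme \<Rightarrow> ('a \<Rightarrow> 'r) \<Rightarrow> ('a \<Rightarrow> 'r) \<Rightarrow> 'r" where
  "chain_inner pos R c d = (\<Oplus>\<^bsub>R\<^esub> e\<in>pos. c e \<otimes>\<^bsub>R\<^esub> d e)"

definition H1 ::
    "('v, 'a) pre_digraph \<Rightarrow> 'a set \<Rightarrow> ('r, 'm) ring_scheme \<Rightarrow> ('a \<Rightarrow> 'r) set" where
  "H1 G pos R = {c \<in> C1 pos R. \<forall>v \<in> verts G.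
     (\<Oplus>\<^bsub>R\<^esub> e\<in>{e \<in> pos. tail G e = v}. c e) = (\<Oplus>\<^bsub>R\<^esub> e\<in>{e \<in> pos. head G e = v}. c e)}"

definition M :: "'a set \<Rightarrow> nat \<Rightarrow> 'a set \<Rightarrow> ('a \<Rightarrow> int) set" where
  "M pos t F = {c \<in> C1 pos (residue_ring (int t)). \<forall>e \<in> pos - F. c e = \<zero>\<^bsub>residue_ring (int t)\<^esub>}"

definition abelianization :: "('a \<Rightarrow> 'a) \<Rightarrow> 'a set \<Rightarrow> 'a list \<Rightarrow> ('a \<Rightarrow> int)" where
  "abelianization arev pos p =
     (\<lambda>e\<in>pos. \<Oplus>\<^bsub>int_ring\<^esub> i\<in>{..<length p}. edge_chain arev pos int_ring (p ! i) e)"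

definition reduce_chain :: "'a set \<Rightarrow> nat \<Rightarrow> ('a \<Rightarrow> int) \<Rightarrow> ('a \<Rightarrow> int)" where
  "reduce_chain pos t c = (\<lambda>e\<in>pos. c e mod int t)"

definition circuit_count ::
    "('v, 'a) pre_digraph \<Rightarrow> ('a \<Rightarrow> 'a) \<Rightarrow> 'a set \<Rightarrow> nat \<Rightarrow> ('a \<Rightarrow> int) \<Rightarrow> nat \<Rightarrow> nat" where
  "circuit_count G arev pos t \<alpha> l = card {p. circuit G arev p \<and> length p = l
     \<and> reduce_chain pos t (abelianization arev pos p) = \<alpha>}"

definition closed_walk_count ::
    "('v, 'a) pre_digraph \<Rightarrow> ('a \<Rightarrow> 'a) \<Rightarrow> 'a set \<Rightarrow> nat \<Rightarrow> ('a \<Rightarrow> int) \<Rightarrow> nat \<Rightarrow> nat" where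
  "closed_walk_count G arev pos t \<alpha> l = card {p. closed_walk G p \<and> length p = l
     \<and> reduce_chain pos t (abelianization arev pos p) = \<alpha>}"

subsection \<open>Characters and twisted matrices\<close>

definition eps :: "nat \<Rightarrow> complex" where
  "eps t = exp (2 * complex_of_real pi * \<i> / of_nat t)"

definition chi :: "('a \<Rightarrow> 'a) \<Rightarrow> 'a set \<Rightarrow> nat \<Rightarrow> ('a \<Rightarrow> int) \<Rightarrow> 'a \<Rightarrow> complex" where
  "chi arev pos t \<gamma> a = eps t powi
     chain_inner pos (residue_ring (int t)) \<gamma> (edge_chain arev pos (residue_ring (int t)) a)"

text \<open>The list \<open>vs\<close> enumerates the vertices.\<close>

definition A_mat :: "('v, 'a) pre_digraph \<Rightarrow> ('a \<Rightarrow> 'a) \<Rightarrow> 'a set \<Rightarrow> 'v list \<Rightarrow> nat \<Rightarrow>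
    ('a \<Rightarrow> int) \<Rightarrow> complex mat" where
  "A_mat G arev pos vs t \<gamma> = mat (length vs) (length vs)
     (\<lambda>(i, j). \<Sum>a\<in>{a \<in> arcs G. tail G a = vs ! i \<and> head G a = vs ! j}. chi arev pos t \<gamma> a)"

definition feeds_into :: "('v, 'a) pre_digraph \<Rightarrow> ('a \<Rightarrow> 'a) \<Rightarrow> 'a \<Rightarrow> 'a \<Rightarrow> bool" where
  "feeds_into G arev a b \<longleftrightarrow> b \<noteq> arev a \<and> head G a = tail G b"

text \<open>The list \<open>as\<close> enumerates all oriented edges.\<close>

definition W_mat :: "('v, 'a) pre_digraph \<Rightarrow> ('a \<Rightarrow> 'a) \<Rightarrow> 'a set \<Rightarrow> 'a list \<Rightarrow> nat \<Rightarrow>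
    ('a \<Rightarrow> int) \<Rightarrow> complex mat" where
  "W_mat G arev pos as t \<gamma> = mat (length as) (length as)
     (\<lambda>(i, j). if feeds_into G arev (as ! i) (as ! j) then chi arev pos t \<gamma> (as ! i) else 0)"

definition mat_trace :: "'b :: comm_monoid_add mat \<Rightarrow> 'b" where
  "mat_trace B = (\<Sum>i<dim_row B. B $$ (i, i))"

end

theory Submission
  imports Defs
begin

text \<open>
  Expanding the matrix powers, the trace of \<open>W\<^sub>1\<^sub>,\<^sub>\<gamma>\<^sup>l\<close> (of \<open>A\<^sub>\<gamma>\<^sup>l\<close>) is the sum of
  \<open>\<epsilon>\<^sub>t\<close> to the power \<open>\<langle>\<gamma>, C\<^sup>a\<^sup>b\<rangle>\<close> over all circuits (closed walks) \<open>C\<close> of length \<open>l\<close>.  Summing over \<open>\<gamma>\<close>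
  first, orthogonality of characters picks out those \<open>C\<close> for which \<open>C\<^sup>a\<^sup>b\<close> and \<open>\<alpha>\<close> agree modulo
  \<open>t\<close> on the \<open>g\<close> positive edges outside the tree.  As the difference is a cycle modulo \<open>t\<close> and a tree
  carries no nonzero cycle, they then agree everywhere.
\<close>

subsection \<open>Orthogonality of characters\<close>

lemma eps_eq_cis: "eps t = cis (2 * pi / real t)"
  by (simp add: eps_def cis_conv_exp mult_ac)

lemma eps_nonzero [simp]: "eps t \<noteq> 0"
  by (simp add: eps_eq_cis)

lemma eps_powi_eq_1_iff:
  assumes "t > 0"
  shows "eps t powi k = 1 \<longleftrightarrow> int t dvd k"
proof
  assume "eps t powi k = 1"
  \<comment> \<open>The real part alone decides: cosine 1 forces the angle to be a multiple of
    \<open>2 * pi\<close>.\<close>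
  then have "cos (of_int k * (2 * pi / real t)) = 1"
    by (simp add: eps_eq_cis cis_power_int complex_eq_iff)
  then obtain n :: int where "of_int k * (2 * pi / real t) = of_int n * 2 * pi"
    by (auto simp: cos_one_2pi_int)
  then have "real_of_int k = real_of_int (n * int t)"
    using assms by (simp add: field_simps)
  then show "int t dvd k"
    by (metis dvd_triv_right of_int_eq_iff)
next
  assume "int t dvd k"
  then obtain n where "k = int t * n" by blast
  then have "eps t powi k = cis (2 * pi * of_int n)"
    using assms by (simp add: eps_eq_cis cis_power_int field_simps)
  then show "eps t powi k = 1" by simp
qed

text \<open>Lets exponents formed from the representatives \<open>0, ..., t - 1\<close> be replaced
  by unreduced integer expressions.\<close>

lemma eps_powi_cong:
  assumes "t > 0" "[a = b] (mod int t)"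
  shows "eps t powi a = eps t powi b"
proof -
  have "eps t powi (a - b) = 1"
    using assms by (simp add: eps_powi_eq_1_iff cong_iff_dvd_diff)
  then show ?thesis by (simp add: power_int_diff)
qed

lemma eps_powi_sum:
  "finite A \<Longrightarrow> eps t powi (\<Sum>x\<in>A. f x) = (\<Prod>x\<in>A. eps t powi f x)"
  by (induction A rule: finite_induct) (auto simp: power_int_add)

text \<open>A geometric series in \<open>w = eps t powi d\<close>: as \<open>w ^ t = 1\<close>, it
  vanishes unless \<open>w = 1\<close>.\<close>

lemma sum_eps_powi:
  assumes "t > 0"
  shows "(\<Sum>k\<in>{0..<int t}. eps t powi (k * d)) = (if int t dvd d then of_nat t else 0)"
proof -
  define w where "w = eps t powi d"
  have "(\<Sum>k\<in>{0..<int t}. eps t powi (k * d)) = (\<Sum>k<t. w ^ k)"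
    by (rule sum.reindex_bij_witness[of _ int nat])
      (auto simp: w_def power_int_power' mult.commute)
  also have "\<dots> = (if int t dvd d then of_nat t else 0)"
  proof (cases "int t dvd d")
    case True
    then have "w = 1" using assms by (simp add: w_def eps_powi_eq_1_iff)
    with True show ?thesis by simp
  next
    case False
    then have "w \<noteq> 1" using assms by (simp add: w_def eps_powi_eq_1_iff)
    moreover have "w ^ t = 1"
      using assms by (simp add: w_def power_int_power' eps_powi_eq_1_iff)
    ultimately show ?thesis using False by (simp add: geometric_sum)
  qed
  finally show ?thesis .
qed

text \<open>The index set is a product, so the sum factors over the coordinates; a coordinate
  outside \<open>F\<close> is frozen at 0 and contributes the factor 1. The index set has the form
  given to \<open>M\<close> by \<open>M_eq_PiE\<close>.\<close>

lemma sum_characters: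
  assumes "finite B" "F \<subseteq> B" "t > 0"
  shows "(\<Sum>\<gamma> \<in> (\<Pi>\<^sub>E e\<in>B. if e \<in> F then {0..<int t} else {0}). eps t powi (\<Sum>e\<in>B. \<gamma> e * d e))
    = (if \<forall>e\<in>F. int t dvd d e then of_nat t ^ card F else 0)"
proof -
  have "(\<Sum>\<gamma> \<in> (\<Pi>\<^sub>E e\<in>B. if e \<in> F then {0..<int t} else {0}). eps t powi (\<Sum>e\<in>B. \<gamma> e * d e))
    = (\<Prod>e\<in>B. \<Sum>k\<in>(if e \<in> F then {0..<int t} else {0}). eps t powi (k * d e))"
    using assms by (subst prod_sum_PiE) (auto simp: eps_powi_sum)
  also have "\<dots> = (\<Prod>e\<in>B. if e \<in> F then if int t dvd d e then of_nat t else 0 else 1)"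
    using assms by (intro prod.cong) (auto simp: sum_eps_powi)
  also have "\<dots> = (\<Prod>e\<in>F. if int t dvd d e then of_nat t else 0)"
    using assms by (simp add: prod.inter_restrict[symmetric] Int_absorb1)
  also have "\<dots> = (if \<forall>e\<in>F. int t dvd d e then of_nat t ^ card F else 0)"
    using assms finite_subset[of F B] by (auto simp: prod_zero_iff)
  finally show ?thesis .
qed

lemma residue_ring_finsum:
  assumes "m > 1" "finite A" "\<And>x. x \<in> A \<Longrightarrow> f x \<in> carrier (residue_ring m)"
  shows "(\<Oplus>\<^bsub>residue_ring m\<^esub> x\<in>A. f x) = (\<Sum>x\<in>A. f x) mod m"
proof -
  interpret residues m "residue_ring m" using assms(1) by unfold_locales auto
  from assms(2,3) show ?thesis
    by (induction A rule: finite_induct) (auto simp: res_add_eq res_zero_eq mod_simps)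
qed

subsection \<open>Traces of matrix powers as sums over walks\<close>

text \<open>The words read along walks of length \<open>n\<close> through the states
  \<open>X\<close>, where \<open>L x y\<close> holds the labels of the steps from \<open>x\<close>
  to \<open>y\<close>. This serves both matrices: the states are vertices for \<open>A_mat\<close>
  and arcs for \<open>W_mat\<close>. Recursion on the last step matches the recursion for matrix
  powers.\<close>

fun label_walks :: "('x \<Rightarrow> 'x \<Rightarrow> 'b set) \<Rightarrow> 'x set \<Rightarrow> nat \<Rightarrow> 'x \<Rightarrow> 'x \<Rightarrow> 'b list set" where
  "label_walks L X 0 x y = (if x = y then {[]} else {})"
| "label_walks L X (Suc n) x y =
    (\<Union>z\<in>X. (\<lambda>(p, a). p @ [a]) ` (label_walks L X n x z \<times> L z y))"

lemma finite_label_walks: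
  assumes "finite X" "\<And>x y. finite (L x y)"
  shows "finite (label_walks L X n x y)"
  using assms by (induction n arbitrary: y) auto

text \<open>The map \<open>s\<close> recovers the source of a step from its label. Hence the last
  letter of a word determines the last intermediate state, and the sum over these states counts no
  word twice.\<close>

lemma pow_mat_label_walks:
  fixes \<chi> :: "'b \<Rightarrow> 'c :: comm_semiring_1" and s :: "'b \<Rightarrow> 'x"
  assumes xs: "distinct xs"
    and L: "\<And>x y. finite (L x y)" "\<And>x y a. a \<in> L x y \<Longrightarrow> s a = x"
    and B: "B = mat (length xs) (length xs) (\<lambda>(i, j). \<Sum>a\<in>L (xs ! i) (xs ! j). \<chi> a)"
    and i: "i < length xs" and j: "j < length xs"
  shows "(B ^\<^sub>m n) $$ (i, j) = (\<Sum>p\<in>label_walks L (set xs) n (xs ! i) (xs ! j). prod_list (map \<chi> p))"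
  using j
proof (induction n arbitrary: j)
  case 0
  with i xs show ?case by (auto simp: B nth_eq_iff_index_eq)
next
  case (Suc n)
  let ?x = "xs ! i" and ?y = "xs ! j"
  let ?W = "\<lambda>n z. label_walks L (set xs) n ?x z"
  have "(B ^\<^sub>m Suc n) $$ (i, j) = (\<Sum>k<length xs. (B ^\<^sub>m n) $$ (i, k) * B $$ (k, j))"
    using i Suc.prems by (simp add: B scalar_prod_def atLeast0LessThan)
  also have "\<dots> = (\<Sum>k<length xs. (\<Sum>p\<in>?W n (xs ! k). prod_list (map \<chi> p))
      * (\<Sum>a\<in>L (xs ! k) ?y. \<chi> a))"
    using Suc by (intro sum.cong) (auto simp: B)
  also have "\<dots> = (\<Sum>z\<in>set xs. (\<Sum>p\<in>?W n z. prod_list (map \<chi> p)) * (\<Sum>a\<in>L z ?y. \<chi> a))"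
    by (rule sum.reindex_bij_betw) (rule bij_betw_nth[OF xs], auto)
  also have "\<dots> = (\<Sum>z\<in>set xs. \<Sum>(p, a)\<in>?W n z \<times> L z ?y. prod_list (map \<chi> (p @ [a])))"
    by (simp add: sum_product sum.cartesian_product)
  also have "\<dots> = (\<Sum>z\<in>set xs. \<Sum>q\<in>(\<lambda>(p, a). p @ [a]) ` (?W n z \<times> L z ?y). prod_list (map \<chi> q))"
    by (intro sum.cong refl, subst sum.reindex) (auto simp: inj_on_def case_prod_unfold)
  also have "\<dots> = (\<Sum>q\<in>?W (Suc n) ?y. prod_list (map \<chi> q))"
    unfolding label_walks.simps
    by (rule sum.UNION_disjoint [symmetric]) (auto simp: finite_label_walks L(1) dest: L(2))
  finally show ?case .
qed

text \<open>The outer sum over \<open>x\<close> is kept because for \<open>n = 0\<close> the empty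
  word occurs at every state. The sets are merged later, for positive lengths.\<close>

lemma mat_trace_pow_label_walks:
  fixes \<chi> :: "'b \<Rightarrow> 'c :: comm_semiring_1"
  assumes xs: "distinct xs"
    and L: "\<And>x y. finite (L x y)" "\<And>x y a. a \<in> L x y \<Longrightarrow> s a = x"
    and B: "B = mat (length xs) (length xs) (\<lambda>(i, j). \<Sum>a\<in>L (xs ! i) (xs ! j). \<chi> a)"
  shows "mat_trace (B ^\<^sub>m n) = (\<Sum>x\<in>set xs. \<Sum>p\<in>label_walks L (set xs) n x x. prod_list (map \<chi> p))"
proof -
  have "mat_trace (B ^\<^sub>m n)
      = (\<Sum>i<length xs. \<Sum>p\<in>label_walks L (set xs) n (xs ! i) (xs ! i). prod_list (map \<chi> p))"
    unfolding mat_trace_def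
    by (intro sum.cong) (auto simp: B intro!: pow_mat_label_walks[OF xs L refl])
  also have "\<dots> = (\<Sum>x\<in>set xs. \<Sum>p\<in>label_walks L (set xs) n x x. prod_list (map \<chi> p))"
    by (rule sum.reindex_bij_betw) (rule bij_betw_nth[OF xs], auto)
  finally show ?thesis .
qed

subsection \<open>Boundaries and spanning trees\<close>

locale oriented_multigraph = multigraph G arev
  for G :: "('v, 'a) pre_digraph" and arev :: "'a \<Rightarrow> 'a" +
  fixes pos :: "'a set"
  assumes orientation: "orientation G arev pos"
begin

lemma pos_subset: "pos \<subseteq> arcs G"
  using orientation by (simp add: orientation_def)

lemma finite_pos [simp]: "finite pos"
  using finite_subset[OF pos_subset] by simp

lemma pos_in_arcs: "a \<in> pos \<Longrightarrow> a \<in> arcs G"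
  using pos_subset by blast

lemma arev_in_pos_iff:
  assumes "a \<in> arcs G"
  shows "arev a \<in> pos \<longleftrightarrow> a \<notin> pos"
proof -
  have "{a, arev a} \<in> edge_set G arev"
    using assms by (simp add: edge_set_def)
  then have "\<exists>!b. b \<in> {a, arev a} \<and> b \<in> pos"
    using orientation[unfolded orientation_def, THEN conjunct2] by (rule bspec[rotated])
  then obtain b where b: "b \<in> {a, arev a} \<and> b \<in> pos"
    and unique: "\<forall>c. c \<in> {a, arev a} \<and> c \<in> pos \<longrightarrow> c = b"
    by (rule ex1E)
  show ?thesis
    using arev_neq[OF assms] b unique[THEN spec, of a] unique[THEN spec, of "arev a"] by auto
qed

lemma arev_notin_pos: "a \<in> pos \<Longrightarrow> arev a \<notin> pos"
  by (simp add: arev_in_pos_iff pos_in_arcs)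

lemma card_edge_set: "card (edge_set G arev) = card pos"
proof -
  have "edge_set G arev = (\<lambda>a. {a, arev a}) ` pos"
  proof -
    have "{a, arev a} \<in> (\<lambda>a. {a, arev a}) ` pos" if "a \<in> arcs G" for a
      using that arev_in_pos_iff[OF that] by (cases "a \<in> pos") (auto intro: rev_image_eqI)
    then show ?thesis unfolding edge_set_def using pos_subset by blast
  qed
  moreover have "inj_on (\<lambda>a. {a, arev a}) pos"
    by (rule inj_onI) (auto simp: doubleton_eq_iff arev_notin_pos)
  ultimately show ?thesis by (simp add: card_image)
qed

text \<open>Outflow minus inflow, over the integers: cycles modulo \<open>t\<close> are the chains
  whose boundary is divisible by \<open>t\<close> at every vertex.\<close>

definition boundary :: "('a \<Rightarrow> int) \<Rightarrow> 'v \<Rightarrow> int" where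
  "boundary c v = (\<Sum>e | e \<in> pos \<and> tail G e = v. c e) - (\<Sum>e | e \<in> pos \<and> head G e = v. c e)"

lemma boundary_alt:
  "boundary c v = (\<Sum>e\<in>pos. c e * (of_bool (tail G e = v) - of_bool (head G e = v)))"
  by (simp add: boundary_def right_diff_distrib sum_subtractf Int_def)

lemma boundary_add: "boundary (\<lambda>e. c e + d e) v = boundary c v + boundary d v"
  by (simp add: boundary_alt distrib_right sum.distrib)

lemma boundary_diff: "boundary (\<lambda>e. c e - d e) v = boundary c v - boundary d v"
  by (simp add: boundary_alt left_diff_distrib sum_subtractf)

lemma boundary_0: "boundary (\<lambda>_. 0) v = 0"
  by (simp add: boundary_alt)

lemma sum_boundary: "(\<Sum>v\<in>verts G. boundary c v) = 0"
proof -
  have "(\<Sum>v\<in>verts G. boundary c v)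
      = (\<Sum>e\<in>pos. \<Sum>v\<in>verts G. c e * (of_bool (tail G e = v) - of_bool (head G e = v)))"
    unfolding boundary_alt by (rule sum.swap)
  \<comment> \<open>Both ends of an edge are vertices of \<open>G\<close>, so its coefficient occurs
    once with each sign.\<close>
  also have "\<dots> = 0"
    by (rule sum.neutral) (auto simp flip: sum_distrib_left simp: sum_subtractf pos_in_arcs)
  finally show ?thesis .
qed

text \<open>The antisymmetric extension of a chain to all oriented edges, so that an edge can be
  traversed in either direction.\<close>

definition signed :: "('a \<Rightarrow> int) \<Rightarrow> 'a \<Rightarrow> int" where
  "signed c a = (if a \<in> pos then c a else - c (arev a))"

lemma signed_arev: "a \<in> arcs G \<Longrightarrow> signed c (arev a) = - signed c a"
  by (simp add: signed_def arev_in_pos_iff)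

text \<open>An outgoing arc that is not positive is the reverse of an incoming positive one, which
  yields the minus sign. A loop leaves \<open>v\<close> in both orientations and cancels on both
  sides.\<close>

lemma sum_signed_out_arcs: "(\<Sum>a\<in>out_arcs G v. signed c a) = boundary c v"
proof -
  let ?H = "{e \<in> pos. head G e = v}"
  have H: "a \<in> arev ` ?H" if "a \<in> arcs G" "tail G a = v" "a \<notin> pos" for a
  proof (rule image_eqI)
    show "a = arev (arev a)" by simp
    show "arev a \<in> ?H" using that by (simp add: arev_in_pos_iff)
  qed
  have out: "out_arcs G v = {e \<in> pos. tail G e = v} \<union> arev ` ?H"
  proof (rule subset_antisym)
    show "out_arcs G v \<subseteq> {e \<in> pos. tail G e = v} \<union> arev ` ?H"
    proof
      fix a assume "a \<in> out_arcs G v"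
      then show "a \<in> {e \<in> pos. tail G e = v} \<union> arev ` ?H"
        using H[of a] by (cases "a \<in> pos") simp_all
    qed
    show "{e \<in> pos. tail G e = v} \<union> arev ` ?H \<subseteq> out_arcs G v"
      by (simp add: subset_iff image_iff) (metis arev_in_arcs pos_in_arcs tail_arev)
  qed
  have disj: "{e \<in> pos. tail G e = v} \<inter> arev ` ?H = {}"
    by (auto simp: arev_notin_pos)
  have "(\<Sum>a\<in>out_arcs G v. signed c a)
      = (\<Sum>a | a \<in> pos \<and> tail G a = v. signed c a) + (\<Sum>a\<in>arev ` ?H. signed c a)"
    unfolding out by (rule sum.union_disjoint[OF _ _ disj]) simp_all
  also have "(\<Sum>a\<in>arev ` ?H. signed c a) = - (\<Sum>e\<in>?H. c e)"
    by (subst sum.reindex) (auto simp: inj_on_arev arev_notin_pos signed_def sum_negf)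
  finally show ?thesis by (simp add: boundary_def signed_def)
qed

end

section \<open>Walks as sequences of consecutive arcs\<close>

lemma cas_conv_successively:
  assumes "p \<noteq> []"
  shows "pre_digraph.cas G u p w \<longleftrightarrow>
    tail G (hd p) = u \<and> successively (\<lambda>a b. head G a = tail G b) p \<and> head G (last p) = w"
  using assms
proof (induction p arbitrary: u)
  case (Cons a p)
  show ?case
  proof (cases "p = []")
    case False
    then show ?thesis
      using Cons.IH[of "head G a"] by (auto simp: pre_digraph.cas.simps successively_Cons)
  qed (simp add: pre_digraph.cas.simps)
qed simp

lemma cas_map_upt:
  assumes "\<And>n. tail T (x (Suc n)) = head T (x n)" "i \<le> j"
  shows "pre_digraph.cas T (tail T (x i)) (map x [i..<j]) (tail T (x j))"
  using assms(2)
proof (induction i rule: inc_induct)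
  case base
  then show ?case by (simp add: pre_digraph.cas.simps)
next
  case (step n)
  then show ?case by (simp add: upt_conv_Cons pre_digraph.cas.simps flip: assms(1))
qed

section \<open>Spanning trees modulo an integer: cycles, potentials and the number of edges\<close>

context oriented_multigraph
begin

text \<open>Otherwise every arc with a coefficient not divisible by \<open>m\<close> can be continued by another one
  without backtracking, and the first repetition closes a circuit in the tree.\<close>

lemma dvd_if_dvd_boundary:
  assumes tree: "is_spanning_tree G arev T"
    and bd: "\<And>v. v \<in> verts G \<Longrightarrow> m dvd boundary c v"
    and off: "\<And>e. e \<in> pos - arcs T \<Longrightarrow> m dvd c e"
    and e: "e \<in> pos"
  shows "m dvd c e"
proof (rule ccontr)
  assume not_dvd: "\<not> m dvd c e"
  have T: "verts T = verts G" "arcs T \<subseteq> arcs G" "tail T = tail G" "head T = head G"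
    "\<And>a. a \<in> arcs T \<Longrightarrow> arev a \<in> arcs T" "\<And>p. \<not> circuit T arev p"
    using tree by (auto simp: is_spanning_tree_def spanning_def subgraph_def compatible_def)
  \<comment> \<open>Divisibility ignores signs, so \<open>S\<close> contains the reverse of each of
    its arcs.\<close>
  define S where "S = {a \<in> arcs G. \<not> m dvd signed c a}"
  have S_T: "a \<in> arcs T" if "a \<in> S" for a
  proof (rule ccontr)
    assume "a \<notin> arcs T"
    then have "arev a \<notin> arcs T" using T(5)[of "arev a"] by auto
    with \<open>a \<notin> arcs T\<close> off that show False
      by (auto simp: S_def signed_def arev_in_pos_iff split: if_splits)
  qed
  \<comment> \<open>If \<open>arev a\<close> were the only arc of \<open>S\<close> leaving the head
    of \<open>a\<close>, the boundary there would be congruent to \<open>signed c (arev a)\<close>,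
    which is not divisible by \<open>m\<close>.\<close>
  have "\<exists>b\<in>S. b \<noteq> arev a \<and> tail G b = head G a" if "a \<in> S" for a
  proof (rule ccontr)
    assume *: "\<not> ?thesis"
    have a: "a \<in> arcs G" using that by (simp add: S_def)
    let ?O = "out_arcs G (head G a)"
    have "boundary c (head G a) = signed c (arev a) + (\<Sum>b\<in>?O - {arev a}. signed c b)"
      unfolding sum_signed_out_arcs[symmetric] using a by (intro sum.remove) auto
    moreover have "m dvd (\<Sum>b\<in>?O - {arev a}. signed c b)"
      using * by (intro dvd_sum) (auto simp: S_def)
    ultimately have "m dvd signed c (arev a)"
      using bd[of "head G a"] a dvd_add_left_iff by auto
    then show False using that a by (simp add: S_def signed_arev)
  qed
  then obtain f where f: "\<And>a. a \<in> S \<Longrightarrow> f a \<in> S \<and> f a \<noteq> arev a \<and> tail G (f a) = head G a"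
    by metis
  define x where "x n = (f ^^ n) e" for n
  have e_S: "e \<in> S" using e not_dvd by (simp add: S_def signed_def pos_in_arcs)
  have x_S: "x n \<in> S" for n
    by (induction n) (auto simp: x_def e_S f)
  have x_Suc: "x (Suc n) \<noteq> arev (x n)" "tail G (x (Suc n)) = head G (x n)" for n
    using f[OF x_S] by (simp_all add: x_def)
  have "finite (range x)"
    using x_S by (rule_tac finite_subset[of _ "arcs G"]) (auto simp: S_def)
  then have "\<not> inj x" using finite_imageD infinite_UNIV_nat by blast
  then obtain i j where ij: "i < j" "x i = x j"
    by (metis injI linorder_neqE_nat)
  define p where "p = map x [i..<j]"
  have "pre_digraph.awalk T (tail T (x i)) p (tail T (x i))"
    unfolding pre_digraph.awalk_def
  proof (intro conjI)
    show "tail T (x i) \<in> verts T" using x_S[of i] by (simp add: T S_def)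
    show "set p \<subseteq> arcs T" using x_S S_T by (auto simp: p_def)
    show "pre_digraph.cas T (tail T (x i)) p (tail T (x i))"
      using cas_map_upt[of T x i j] ij x_Suc by (simp add: p_def T)
  qed
  then have "closed_walk T p" using ij by (auto simp: closed_walk_def p_def)
  moreover have "p ! Suc k \<noteq> arev (p ! k)" if "Suc k < length p" for k
    using that x_Suc(1)[of "i + k"] by (simp add: p_def)
  moreover have "last p \<noteq> arev (hd p)"
  proof -
    \<comment> \<open>Since \<open>x i = x j\<close>, the first arc of \<open>p\<close> is also the
      successor of its last arc, so the absence of a tail is one more instance of the absence of
      backtracking.\<close>
    obtain k where k: "j = Suc k" using ij(1) by (cases j) auto
    have "last p = x k" "hd p = x j" using ij k by (simp_all add: p_def hd_map del: upt_Suc) simp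
    with x_Suc(1)[of k] k show ?thesis by auto
  qed
  ultimately have "circuit T arev p" by (simp add: circuit_def)
  with T(6) show False by blast
qed

text \<open>Modulo \<open>m\<close>, the function \<open>d\<close> agrees at the two ends of every
  tree edge; as the tree is connected, the value 0 at \<open>r\<close> spreads to all
  vertices.\<close>

lemma dvd_if_dvd_coboundary:
  assumes tree: "is_spanning_tree G arev T"
    and r: "r \<in> verts G" "m dvd d r"
    and cobd: "\<And>e. e \<in> pos \<inter> arcs T \<Longrightarrow> m dvd d (tail G e) - d (head G e)"
    and v: "v \<in> verts G"
  shows "(m :: int) dvd d v"
proof -
  have T: "verts T = verts G" "arcs T \<subseteq> arcs G" "tail T = tail G" "head T = head G"
    "\<And>a. a \<in> arcs T \<Longrightarrow> arev a \<in> arcs T" "connected T"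
    using tree by (auto simp: is_spanning_tree_def spanning_def subgraph_def compatible_def)
  have diff: "m dvd d (tail G a) - d (head G a)" if "a \<in> arcs T" for a
  proof (cases "a \<in> pos")
    case False
    with that T have "m dvd d (tail G (arev a)) - d (head G (arev a))"
      by (intro cobd) (auto simp: arev_in_pos_iff)
    with that T have "m dvd d (head G a) - d (tail G a)" by auto
    then show ?thesis by (simp add: dvd_diff_commute)
  qed (use that cobd in auto)
  have "(r, v) \<in> rtrancl_on (verts T) ((arcs_ends T)\<^sup>s)"
    using T(6) r v unfolding connected_conv T(1) by blast
  then show ?thesis
  proof (induction rule: rtrancl_on_induct)
    case base
    then show ?case using r by simp
  next
    case (step y z)
    then obtain a where a: "a \<in> arcs T"
      "y = tail G a \<and> z = head G a \<or> z = tail G a \<and> y = head G a"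
      by (auto simp: symcl_def arcs_ends_conv T)
    have "m dvd d y - d z"
      using diff[OF a(1)] a(2) by (auto simp: dvd_diff_commute)
    with step.IH show ?case
      using dvd_diff[of m "d y" "d y - d z"] by simp
  qed
qed

text \<open>Modulo 2, the boundary map from the chains on the tree to the functions on the vertices other
  than a root is injective because the tree has no circuits, and its transpose is injective because
  the tree is connected.\<close>

lemma card_pos_tree:
  assumes tree: "is_spanning_tree G arev T"
  shows "card (verts G) = Suc (card (pos \<inter> arcs T))"
proof -
  define Q where "Q = pos \<inter> arcs T"
  obtain r where r: "r \<in> verts G"
    using connected by (auto simp: connected_conv)
  define V where "V = verts G - {r}"
  have fin: "finite Q" "finite V" by (simp_all add: Q_def V_def)
  have K: "a = b" if "a \<in> {0, 1}" "b \<in> {0, 1}" "2 dvd a - b" for a b :: int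
    using that by auto
  \<comment> \<open>Extension by zero to all edges and to all vertices; in particular
    \<open>zV f\<close> vanishes at the root.\<close>
  define zQ where "zQ c = (\<lambda>e. if e \<in> Q then c e else 0 :: int)" for c
  define zV where "zV f = (\<lambda>v. if v \<in> V then f v else 0 :: int)" for f
  \<comment> \<open>The functions with values in \<open>{0, 1}\<close> represent the chains modulo
    2. Injections both ways make the two powers of 2 equal, hence also their exponents.\<close>
  have "card (Q \<rightarrow>\<^sub>E {0, 1 :: int}) \<le> card (V \<rightarrow>\<^sub>E {0, 1 :: int})"
  proof (rule card_inj_on_le)
    show "inj_on (\<lambda>c. \<lambda>v\<in>V. boundary (zQ c) v mod 2) (Q \<rightarrow>\<^sub>E {0, 1})"
    proof (rule inj_onI)
      fix c d assume c: "c \<in> Q \<rightarrow>\<^sub>E {0, 1 :: int}" and d: "d \<in> Q \<rightarrow>\<^sub>E {0, 1}"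
        and eq: "(\<lambda>v\<in>V. boundary (zQ c) v mod 2) = (\<lambda>v\<in>V. boundary (zQ d) v mod 2)"
      let ?b = "boundary (\<lambda>e. zQ c e - zQ d e)"
      have V: "2 dvd ?b v" if "v \<in> V" for v
        using fun_cong[OF eq, of v] that by (simp add: boundary_diff mod_eq_dvd_iff)
      \<comment> \<open>The map records no boundary at the root, but there it is determined by the
        others, as the total is zero.\<close>
      have "?b r = - (\<Sum>v\<in>V. ?b v)"
        using sum_boundary[of "\<lambda>e. zQ c e - zQ d e"]
        by (simp add: V_def sum.remove[OF finite_verts r])
      then have "2 dvd ?b r" using V by (simp add: dvd_sum)
      with V have b: "2 dvd ?b v" if "v \<in> verts G" for v
        using that by (cases "v = r") (auto simp: V_def)
      have "2 dvd zQ c e - zQ d e" if "e \<in> pos" for e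
        by (rule dvd_if_dvd_boundary[OF tree b _ that]) (auto simp: zQ_def Q_def)
      then have "2 dvd c e - d e" if "e \<in> Q" for e
        using that by (force simp: zQ_def Q_def)
      then have "c e = d e" if "e \<in> Q" for e
        using that c d by (intro K) (simp_all add: PiE_iff)
      then show "c = d" using c d by (intro PiE_ext)
    qed
    show "(\<lambda>c. \<lambda>v\<in>V. boundary (zQ c) v mod 2) ` (Q \<rightarrow>\<^sub>E {0, 1}) \<subseteq> V \<rightarrow>\<^sub>E {0, 1}"
      by auto
    show "finite (V \<rightarrow>\<^sub>E {0, 1 :: int})" using fin by (simp add: finite_PiE)
  qed
  moreover have "card (V \<rightarrow>\<^sub>E {0, 1 :: int}) \<le> card (Q \<rightarrow>\<^sub>E {0, 1 :: int})"
  proof (rule card_inj_on_le)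
    \<comment> \<open>The transpose of the previous map: differences of a function on the vertices
      along the tree edges.\<close>
    let ?h = "\<lambda>f. \<lambda>e\<in>Q. (zV f (tail G e) - zV f (head G e)) mod 2"
    show "inj_on ?h (V \<rightarrow>\<^sub>E {0, 1})"
    proof (rule inj_onI)
      fix c d assume c: "c \<in> V \<rightarrow>\<^sub>E {0, 1 :: int}" and d: "d \<in> V \<rightarrow>\<^sub>E {0, 1}"
        and eq: "?h c = ?h d"
      let ?d = "\<lambda>v. zV c v - zV d v"
      have cobd: "2 dvd ?d (tail G e) - ?d (head G e)" if "e \<in> Q" for e
        using fun_cong[OF eq, of e] that by (simp add: mod_eq_dvd_iff algebra_simps)
      have "2 dvd ?d v" if "v \<in> verts G" for v
        by (rule dvd_if_dvd_coboundary[OF tree r _ _ that, where d = ?d], use cobd in \<open>auto simp: zV_def Q_def V_def\<close>)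
      then have "2 dvd c v - d v" if "v \<in> V" for v
        using that by (force simp: zV_def V_def)
      then have "c v = d v" if "v \<in> V" for v
        using that c d by (intro K) (simp_all add: PiE_iff)
      then show "c = d" using c d by (intro PiE_ext)
    qed
    show "?h ` (V \<rightarrow>\<^sub>E {0, 1}) \<subseteq> Q \<rightarrow>\<^sub>E {0, 1}"
      by auto
    show "finite (Q \<rightarrow>\<^sub>E {0, 1 :: int})" using fin by (simp add: finite_PiE)
  qed
  ultimately have "card Q = card V" using fin by (simp add: card_funcsetE)
  moreover have "card (verts G) = Suc (card V)"
    unfolding V_def using r by (intro card.remove) simp_all
  ultimately show ?thesis by (simp add: Q_def)
qed

text \<open>Source of the exponent \<open>g\<close>: of the \<open>m\<close> positive edges,
  \<open>n - 1\<close> lie in the tree.\<close>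

lemma card_cotree:
  assumes "is_spanning_tree G arev T"
  shows "card (cotree pos T) = genus G arev"
proof -
  have "card pos = card (pos \<inter> arcs T) + card (cotree pos T)"
    unfolding cotree_def by (rule card_Int_Diff) simp
  then show ?thesis
    unfolding genus_def card_edge_set card_pos_tree[OF assms] by linarith
qed

subsection \<open>Chains of closed walks\<close>

text \<open>An integer form of \<open>edge_chain\<close> that stands for it over both coefficient
  rings.\<close>

definition arc_chain :: "'a \<Rightarrow> 'a \<Rightarrow> int" where
  "arc_chain a e = of_bool (e = a) - of_bool (e = arev a)"

definition flow :: "'a list \<Rightarrow> 'a \<Rightarrow> int" where
  "flow p e = (\<Sum>a\<leftarrow>p. arc_chain a e)"

lemma boundary_arc_chain:
  assumes "a \<in> arcs G"
  shows "boundary (arc_chain a) v = of_bool (tail G a = v) - of_bool (head G a = v)"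
proof -
  define X where "X e = (of_bool (tail G e = v) - of_bool (head G e = v) :: int)" for e
  have delta: "(\<Sum>e\<in>pos. of_bool (e = b) * X e) = (if b \<in> pos then X b else 0)" for b
  proof -
    have "(\<Sum>e\<in>pos. of_bool (e = b) * X e) = (\<Sum>e\<in>pos. if e = b then X e else 0)"
      by (intro sum.cong) auto
    then show ?thesis by (simp add: sum.delta)
  qed
  have "boundary (arc_chain a) v
      = (\<Sum>e\<in>pos. of_bool (e = a) * X e) - (\<Sum>e\<in>pos. of_bool (e = arev a) * X e)"
    by (simp only: boundary_alt X_def arc_chain_def left_diff_distrib sum_subtractf)
  \<comment> \<open>Exactly one of \<open>a\<close> and \<open>arev a\<close> is positive, and
    \<open>X (arev a) = - X a\<close>.\<close>
  also have "\<dots> = X a"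
    unfolding delta using assms arev_in_pos_iff[OF assms] by (simp add: X_def)
  finally show ?thesis by (simp add: X_def)
qed

text \<open>The boundaries of the arcs telescope along the walk; for a closed walk the two ends
  cancel.\<close>

lemma boundary_flow:
  "awalk u p w \<Longrightarrow> boundary (flow p) v = of_bool (u = v) - of_bool (w = v)"
proof (induction p arbitrary: u)
  case Nil
  then show ?case by (simp add: flow_def awalk_Nil_iff boundary_0)
next
  case (Cons a p)
  have "flow (a # p) = (\<lambda>e. arc_chain a e + flow p e)"
    by (simp add: flow_def fun_eq_iff)
  with Cons.prems Cons.IH[of "head G a"] show ?case
    by (auto simp: boundary_add boundary_arc_chain awalk_Cons_iff)
qed

lemma abelianization_eq_flow:
  assumes "set p \<subseteq> arcs G" "e \<in> pos"
  shows "abelianization arev pos p e = flow p e"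
proof -
  have "edge_chain arev pos int_ring a e = arc_chain a e" if "a \<in> arcs G" for a
    unfolding edge_chain_def arc_chain_def int_a_inv_eq
    using assms(2) arev_neq[OF that] by simp
  moreover have "p ! i \<in> arcs G" if "i < length p" for i
    using that assms(1) by (meson nth_mem subsetD)
  ultimately show ?thesis
    using assms(2)
    by (simp add: abelianization_def flow_def sum_list_sum_nth atLeast0LessThan int_finsum_eq)
qed

lemma boundary_H1:
  assumes t: "t \<ge> 2" and \<alpha>: "\<alpha> \<in> H1 G pos (residue_ring (int t))" and v: "v \<in> verts G"
  shows "int t dvd boundary \<alpha> v"
proof -
  let ?R = "residue_ring (int t)"
  have car: "\<alpha> e \<in> carrier ?R" if "e \<in> pos" for e
    using \<alpha> that by (auto simp: H1_def C1_def)
  have "(\<Oplus>\<^bsub>?R\<^esub> e\<in>{e \<in> pos. tail G e = v}. \<alpha> e) = (\<Oplus>\<^bsub>?R\<^esub> e\<in>{e \<in> pos. head G e = v}. \<alpha> e)"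
    using \<alpha> v by (simp add: H1_def)
  then have "(\<Sum>e\<in>{e \<in> pos. tail G e = v}. \<alpha> e) mod int t
      = (\<Sum>e\<in>{e \<in> pos. head G e = v}. \<alpha> e) mod int t"
    using t car by (subst (asm) (1 2) residue_ring_finsum) auto
  then show ?thesis by (simp add: boundary_def mod_eq_dvd_iff)
qed

section \<open>Characters of walks as powers of the root of unity\<close>

lemma chain_inner_residue_ring:
  assumes "t \<ge> 2"
  shows "chain_inner pos (residue_ring (int t)) c d = (\<Sum>e\<in>pos. c e * d e) mod int t"
proof -
  interpret residues "int t" "residue_ring (int t)"
    using assms by unfold_locales auto
  show ?thesis
    unfolding chain_inner_def using assms
    by (subst residue_ring_finsum) (auto simp: res_mult_eq mod_sum_eq)
qed

text \<open>In \<open>residue_ring\<close> the coefficient -1 is represented by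
  \<open>t - 1\<close>; the power of \<open>eps t\<close> does not see the difference.\<close>

lemma chi_eq:
  assumes t: "t \<ge> 2" and a: "a \<in> arcs G"
  shows "chi arev pos t \<gamma> a = eps t powi (\<Sum>e\<in>pos. \<gamma> e * arc_chain a e)"
proof -
  interpret residues "int t" "residue_ring (int t)"
    using t by unfold_locales auto
  have "[edge_chain arev pos (residue_ring (int t)) a e = arc_chain a e] (mod int t)" if "e \<in> pos" for e
    using that arev_neq[OF a]
    by (simp add: edge_chain_def arc_chain_def res_one_eq res_zero_eq res_neg_eq cong_def)
  then have "[(\<Sum>e\<in>pos. \<gamma> e * edge_chain arev pos (residue_ring (int t)) a e)
      = (\<Sum>e\<in>pos. \<gamma> e * arc_chain a e)] (mod int t)"
    by (intro cong_sum cong_mult) auto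
  then show ?thesis
    unfolding chi_def chain_inner_residue_ring[OF t]
    using t by (intro eps_powi_cong) (auto simp: cong_def)
qed

lemma prod_list_chi:
  assumes t: "t \<ge> 2" and p: "set p \<subseteq> arcs G"
  shows "prod_list (map (chi arev pos t \<gamma>) p) = eps t powi (\<Sum>e\<in>pos. \<gamma> e * flow p e)"
  using p
proof (induction p)
  case (Cons a p)
  then show ?case
    by (simp add: chi_eq[OF t] flow_def distrib_left sum.distrib power_int_add)
qed (simp add: flow_def)

lemma M_eq_PiE:
  assumes "t > 0"
  shows "M pos t F = (\<Pi>\<^sub>E e\<in>pos. if e \<in> F then {0..<int t} else {0})"
proof -
  have coefficient: "x \<in> {0..int t - 1} \<and> (e \<notin> F \<longrightarrow> x = 0)
      \<longleftrightarrow> x \<in> (if e \<in> F then {0..<int t} else {0})" for x e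
    using assms by auto
  have "M pos t F = {c \<in> extensional pos. \<forall>e\<in>pos. c e \<in> {0..int t - 1} \<and> (e \<notin> F \<longrightarrow> c e = 0)}"
    unfolding M_def C1_def residue_ring_def PiE_def Pi_def by (simp, blast)
  then show ?thesis
    unfolding coefficient PiE_def Pi_def by (simp, blast)
qed

text \<open>The flow of a closed walk and \<open>\<alpha>\<close> are both cycles modulo
  \<open>t\<close>. If their difference vanishes modulo \<open>t\<close> off the tree, it vanishes
  everywhere by \<open>dvd_if_dvd_boundary\<close>, so characters supported on the cotree suffice to
  detect the class.\<close>

lemma flow_cong_iff:
  assumes t: "t \<ge> 2" and tree: "is_spanning_tree G arev T"
    and \<alpha>: "\<alpha> \<in> H1 G pos (residue_ring (int t))" and p: "closed_walk G p"
  shows "reduce_chain pos t (abelianization arev pos p) = \<alpha> \<longleftrightarrow>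
    (\<forall>e\<in>cotree pos T. int t dvd flow p e - \<alpha> e)"
proof
  obtain u where u: "awalk u p u" using p by (auto simp: closed_walk_def)
  then have set_p: "set p \<subseteq> arcs G" by (simp add: awalk_def)
  have \<alpha>_PiE: "\<alpha> \<in> pos \<rightarrow>\<^sub>E {0..int t - 1}"
    using \<alpha> by (simp add: H1_def C1_def residue_ring_def)
  have red: "reduce_chain pos t (abelianization arev pos p) = (\<lambda>e\<in>pos. flow p e mod int t)"
    using abelianization_eq_flow[OF set_p] by (auto simp: reduce_chain_def)
  {
    assume "reduce_chain pos t (abelianization arev pos p) = \<alpha>"
    then have "\<alpha> = (\<lambda>e\<in>pos. flow p e mod int t)" by (simp add: red)
    then show "\<forall>e\<in>cotree pos T. int t dvd flow p e - \<alpha> e"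
      by (auto simp: cotree_def mod_eq_dvd_iff[symmetric])
  next
    assume off: "\<forall>e\<in>cotree pos T. int t dvd flow p e - \<alpha> e"
    have bd: "int t dvd boundary (\<lambda>e. flow p e - \<alpha> e) v" if "v \<in> verts G" for v
      using boundary_H1[OF t \<alpha> that] by (simp add: boundary_diff boundary_flow[OF u])
    have "int t dvd flow p e - \<alpha> e" if "e \<in> pos" for e
      by (rule dvd_if_dvd_boundary[OF tree bd _ that])
        (use off in \<open>auto simp: cotree_def\<close>)
    \<comment> \<open>The coefficients of \<open>\<alpha>\<close> are already reduced, so congruence
      becomes equality.\<close>
    moreover have "\<alpha> e mod int t = \<alpha> e" if "e \<in> pos" for e
      using \<alpha>_PiE that by (auto simp: PiE_iff)
    ultimately have "flow p e mod int t = \<alpha> e" if "e \<in> pos" for e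
      using that by (metis mod_eq_dvd_iff)
    then show "reduce_chain pos t (abelianization arev pos p) = \<alpha>"
      using \<alpha>_PiE by (auto simp: red fun_eq_iff PiE_iff extensional_def)
  }
qed

text \<open>After exchanging the sums, each walk contributes a full character sum in its difference
  from \<open>\<alpha>\<close>. Leaving the set \<open>P\<close> of closed walks arbitrary lets both
  formulas follow from this.\<close>

lemma sum_characters_closed_walks:
  assumes t: "t \<ge> 2" and tree: "is_spanning_tree G arev T"
    and \<alpha>: "\<alpha> \<in> H1 G pos (residue_ring (int t))"
    and P: "finite P" "\<And>p. p \<in> P \<Longrightarrow> closed_walk G p"
  shows "(\<Sum>\<gamma>\<in>M pos t (cotree pos T). eps t powi (- chain_inner pos (residue_ring (int t)) \<gamma> \<alpha>)
        * (\<Sum>p\<in>P. prod_list (map (chi arev pos t \<gamma>) p)))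
    = of_nat t ^ genus G arev
        * of_nat (card {p \<in> P. reduce_chain pos t (abelianization arev pos p) = \<alpha>})"
proof -
  let ?F = "cotree pos T"
  have F: "?F \<subseteq> pos" by (auto simp: cotree_def)
  have summand: "eps t powi (- chain_inner pos (residue_ring (int t)) \<gamma> \<alpha>)
      * prod_list (map (chi arev pos t \<gamma>) p)
    = eps t powi (\<Sum>e\<in>pos. \<gamma> e * (flow p e - \<alpha> e))" if "p \<in> P" for \<gamma> p
  proof -
    have "set p \<subseteq> arcs G"
      using P(2)[OF that] by (auto simp: closed_walk_def awalk_def)
    then have "eps t powi (- chain_inner pos (residue_ring (int t)) \<gamma> \<alpha>)
        * prod_list (map (chi arev pos t \<gamma>) p)
      = eps t powi (- ((\<Sum>e\<in>pos. \<gamma> e * \<alpha> e) mod int t) + (\<Sum>e\<in>pos. \<gamma> e * flow p e))"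
      by (simp add: prod_list_chi[OF t] chain_inner_residue_ring[OF t] flip: power_int_add)
    also have "\<dots> = eps t powi (- (\<Sum>e\<in>pos. \<gamma> e * \<alpha> e) + (\<Sum>e\<in>pos. \<gamma> e * flow p e))"
      using t by (intro eps_powi_cong) (auto simp: cong_def mod_simps)
    also have "- (\<Sum>e\<in>pos. \<gamma> e * \<alpha> e) + (\<Sum>e\<in>pos. \<gamma> e * flow p e)
        = (\<Sum>e\<in>pos. \<gamma> e * (flow p e - \<alpha> e))"
      by (simp add: right_diff_distrib sum_subtractf)
    finally show ?thesis .
  qed
  have "(\<Sum>\<gamma>\<in>M pos t ?F. eps t powi (- chain_inner pos (residue_ring (int t)) \<gamma> \<alpha>)
        * (\<Sum>p\<in>P. prod_list (map (chi arev pos t \<gamma>) p)))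
      = (\<Sum>p\<in>P. \<Sum>\<gamma>\<in>M pos t ?F. eps t powi (\<Sum>e\<in>pos. \<gamma> e * (flow p e - \<alpha> e)))"
    unfolding sum_distrib_left by (subst sum.swap) (simp add: summand)
  also have "\<dots> = (\<Sum>p\<in>P. if reduce_chain pos t (abelianization arev pos p) = \<alpha>
      then of_nat t ^ genus G arev else 0)"
    using t F P(2)
    by (intro sum.cong refl)
      (simp add: M_eq_PiE sum_characters flow_cong_iff[OF t tree \<alpha>] card_cotree[OF tree])
  also have "\<dots> = of_nat t ^ genus G arev
        * of_nat (card {p \<in> P. reduce_chain pos t (abelianization arev pos p) = \<alpha>})"
    using P(1) by (simp add: sum.If_cases Int_def)
  finally show ?thesis .
qed

section \<open>Closed walks and circuits as the words counted by the traces\<close>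

lemma closed_walk_conv:
  "closed_walk G p \<longleftrightarrow> p \<noteq> [] \<and> set p \<subseteq> arcs G \<and>
    successively (\<lambda>a b. head G a = tail G b) (p @ [hd p])"
proof (cases "p = []")
  case False
  then have "tail G (hd p) \<in> verts G" if "set p \<subseteq> arcs G"
    using that by (meson hd_in_set subsetD tail_in_verts)
  with False show ?thesis
    by (auto simp: closed_walk_def awalk_def cas_conv_successively successively_append_iff)
qed (simp add: closed_walk_def)

text \<open>Appending \<open>hd p\<close> makes the condition cyclic: the pair formed by the last
  and the first arc expresses both closedness and the absence of a tail.\<close>

lemma circuit_conv:
  "circuit G arev p \<longleftrightarrow> p \<noteq> [] \<and> set p \<subseteq> arcs G \<and> successively (feeds_into G arev) (p @ [hd p])"
proof -
  \<comment> \<open>The definition of \<open>circuit\<close> reverses the first arc,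
    \<open>feeds_into\<close> the last one; for an involution this is the same.\<close>
  have "last p \<noteq> arev (hd p) \<longleftrightarrow> hd p \<noteq> arev (last p)"
    by (metis arev_arev)
  moreover have "successively (feeds_into G arev) p \<longleftrightarrow> successively (\<lambda>a b. head G a = tail G b) p
      \<and> (\<forall>i. Suc i < length p \<longrightarrow> p ! Suc i \<noteq> arev (p ! i))"
    unfolding successively_conv_nth feeds_into_def by blast
  ultimately show ?thesis
    by (auto simp: circuit_def closed_walk_conv successively_append_iff feeds_into_def)
qed

lemma label_walks_awalk:
  assumes "u \<in> verts G" "w \<in> verts G"
  shows "label_walks (\<lambda>x y. {a \<in> arcs G. tail G a = x \<and> head G a = y}) (verts G) n u w
    = {p. awalk u p w \<and> length p = n}"
  using assms(2)
proof (induction n arbitrary: w)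
  case 0
  then show ?case using assms by (auto simp: awalk_Nil_iff)
next
  case (Suc n)
  have "awalk u p w \<and> length p = Suc n \<longleftrightarrow>
      (\<exists>z\<in>verts G. \<exists>q a. p = q @ [a] \<and> (awalk u q z \<and> length q = n)
        \<and> a \<in> arcs G \<and> tail G a = z \<and> head G a = w)" for p
  proof
    assume p: "awalk u p w \<and> length p = Suc n"
    then obtain q a where "p = q @ [a]" "length q = n"
      by (metis length_Suc_conv_rev)
    with p show "\<exists>z\<in>verts G. \<exists>q a. p = q @ [a] \<and> (awalk u q z \<and> length q = n)
        \<and> a \<in> arcs G \<and> tail G a = z \<and> head G a = w"
      by (intro bexI[of _ "tail G a"] exI[of _ q] exI[of _ a])
        (auto simp: awalk_append_iff awalk_simps)
  next
    assume "\<exists>z\<in>verts G. \<exists>q a. p = q @ [a] \<and> (awalk u q z \<and> length q = n)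
        \<and> a \<in> arcs G \<and> tail G a = z \<and> head G a = w"
    then show "awalk u p w \<and> length p = Suc n"
      using Suc.prems by (auto simp: awalk_append_iff awalk_simps)
  qed
  then show ?case
    by (auto simp: Suc.IH image_iff)
qed

text \<open>A step is labelled by its source because an entry of \<open>W_mat\<close> is the
  character of its row arc. The word therefore omits the final arc \<open>b\<close>, which is
  appended again; the condition on \<open>hd\<close> also covers the empty word, where it forces
  \<open>a = b\<close>.\<close>

lemma label_walks_feeds_into:
  assumes "b \<in> arcs G"
  shows "label_walks (\<lambda>x y. if feeds_into G arev x y then {x} else {}) (arcs G) n a b
    = {p. length p = n \<and> set p \<subseteq> arcs G \<and> hd (p @ [b]) = a
        \<and> successively (feeds_into G arev) (p @ [b])}"
  using assms
proof (induction n arbitrary: b)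
  case 0
  then show ?case by auto
next
  case (Suc n)
  let ?Q = "\<lambda>n b p. length p = n \<and> set p \<subseteq> arcs G \<and> hd (p @ [b]) = a
        \<and> successively (feeds_into G arev) (p @ [b])"
  have "?Q (Suc n) b p \<longleftrightarrow> (\<exists>z\<in>arcs G. \<exists>q. p = q @ [z] \<and> ?Q n z q \<and> feeds_into G arev z b)" for p
  proof
    assume p: "?Q (Suc n) b p"
    then obtain q z where "p = q @ [z]" "length q = n"
      by (metis length_Suc_conv_rev)
    with p show "\<exists>z\<in>arcs G. \<exists>q. p = q @ [z] \<and> ?Q n z q \<and> feeds_into G arev z b"
      by (intro bexI[of _ z] exI[of _ q]) (auto simp: successively_append_iff hd_append)
  qed (auto simp: successively_append_iff hd_append)
  then show ?case
    by (auto simp: Suc.IH image_iff split: if_splits)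
qed

lemma mat_trace_A_mat_pow:
  assumes vs: "distinct vs" "set vs = verts G" and l: "l \<ge> 1"
  shows "mat_trace (A_mat G arev pos vs t \<gamma> ^\<^sub>m l)
    = (\<Sum>p | closed_walk G p \<and> length p = l. prod_list (map (chi arev pos t \<gamma>) p))"
proof -
  let ?L = "\<lambda>x y. {a \<in> arcs G. tail G a = x \<and> head G a = y}"
  let ?W = "\<lambda>u. label_walks ?L (verts G) l u u"
  have "mat_trace (A_mat G arev pos vs t \<gamma> ^\<^sub>m l)
      = (\<Sum>u\<in>verts G. \<Sum>p\<in>?W u. prod_list (map (chi arev pos t \<gamma>) p))"
    unfolding vs(2)[symmetric]
    by (rule mat_trace_pow_label_walks[OF vs(1), where s = "tail G"]) (auto simp: A_mat_def)
  also have "\<dots> = (\<Sum>p\<in>(\<Union>u\<in>verts G. ?W u). prod_list (map (chi arev pos t \<gamma>) p))"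
  proof (rule sum.UNION_disjoint[symmetric])
    \<comment> \<open>As \<open>l\<close> is positive, the word is nonempty and its first arc
      determines the base vertex, so no closed walk is counted at two vertices.\<close>
    have "u = tail G (hd p)" if "u \<in> verts G" "p \<in> ?W u" for u p
      using that l by (cases p) (auto simp: label_walks_awalk awalk_simps)
    then show "\<forall>u\<in>verts G. \<forall>w\<in>verts G. u \<noteq> w \<longrightarrow> ?W u \<inter> ?W w = {}"
      by blast
  qed (simp_all add: finite_label_walks)
  also have "(\<Union>u\<in>verts G. ?W u) = {p. closed_walk G p \<and> length p = l}"
    using l by (auto simp: label_walks_awalk closed_walk_def dest: awalk_hd_in_verts)
  finally show ?thesis .
qed

lemma mat_trace_W_mat_pow:
  assumes as: "distinct as" "set as = arcs G" and l: "l \<ge> 1"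
  shows "mat_trace (W_mat G arev pos as t \<gamma> ^\<^sub>m l)
    = (\<Sum>p | circuit G arev p \<and> length p = l. prod_list (map (chi arev pos t \<gamma>) p))"
proof -
  let ?L = "\<lambda>x y. if feeds_into G arev x y then {x} else {}"
  let ?W = "\<lambda>a. label_walks ?L (arcs G) l a a"
  have "mat_trace (W_mat G arev pos as t \<gamma> ^\<^sub>m l)
      = (\<Sum>a\<in>arcs G. \<Sum>p\<in>?W a. prod_list (map (chi arev pos t \<gamma>) p))"
    unfolding as(2)[symmetric]
    by (rule mat_trace_pow_label_walks[OF as(1), where s = "\<lambda>a. a"])
      (auto simp: W_mat_def if_distrib cong: if_cong split: if_splits)
  also have "\<dots> = (\<Sum>p\<in>(\<Union>a\<in>arcs G. ?W a). prod_list (map (chi arev pos t \<gamma>) p))"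
  proof (rule sum.UNION_disjoint[symmetric])
    \<comment> \<open>Here the base state is the first letter itself, so each circuit is counted
      once, as a sequence.\<close>
    have "a = hd p" if "a \<in> arcs G" "p \<in> ?W a" for a p
      using that l by (cases p) (auto simp: label_walks_feeds_into)
    then show "\<forall>a\<in>arcs G. \<forall>b\<in>arcs G. a \<noteq> b \<longrightarrow> ?W a \<inter> ?W b = {}"
      by blast
  qed (simp_all add: finite_label_walks)
  also have "(\<Union>a\<in>arcs G. ?W a) = {p. circuit G arev p \<and> length p = l}"
  proof (intro subset_antisym subsetI)
    fix p assume "p \<in> (\<Union>a\<in>arcs G. ?W a)"
    then obtain a where "a \<in> arcs G" "p \<in> ?W a" by blast
    then show "p \<in> {p. circuit G arev p \<and> length p = l}"
      using l by (cases p) (simp_all add: label_walks_feeds_into circuit_conv)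
  next
    fix p assume "p \<in> {p. circuit G arev p \<and> length p = l}"
    then have "hd p \<in> arcs G" "p \<in> ?W (hd p)"
      using l by (cases p; simp add: label_walks_feeds_into circuit_conv)+
    then show "p \<in> (\<Union>a\<in>arcs G. ?W a)" by blast
  qed
  finally show ?thesis .
qed

end

section \<open>The trace formulas for circuits and for closed walks\<close>

theorem theorem3p4:
  fixes G T :: "('v, 'a) pre_digraph" and arev :: "'a \<Rightarrow> 'a" and pos :: "'a set"
    and vs :: "'v list" and as :: "'a list" and t l :: nat and \<alpha> :: "'a \<Rightarrow> int"
  assumes graph: "multigraph G arev"
    and orient: "orientation G arev pos"
    and tree: "is_spanning_tree G arev T"
    and vs: "distinct vs" "set vs = verts G"
    and as: "distinct as" "set as = arcs G"
    and t: "t \<ge> 2"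
    and \<alpha>: "\<alpha> \<in> H1 G pos (residue_ring (int t))"
    and l: "l \<ge> 1"
  shows "of_nat (circuit_count G arev pos t \<alpha> l) =
      1 / of_nat t ^ genus G arev *
        (\<Sum>\<gamma> \<in> M pos t (cotree pos T).
          eps t powi (- chain_inner pos (residue_ring (int t)) \<gamma> \<alpha>)
            * mat_trace (W_mat G arev pos as t \<gamma> ^\<^sub>m l))
    \<and> of_nat (closed_walk_count G arev pos t \<alpha> l) =
      1 / of_nat t ^ genus G arev *
        (\<Sum>\<gamma> \<in> M pos t (cotree pos T).
          eps t powi (- chain_inner pos (residue_ring (int t)) \<gamma> \<alpha>)
            * mat_trace (A_mat G arev pos vs t \<gamma> ^\<^sub>m l))"
proof -
  interpret oriented_multigraph G arev pos
    using graph orient by (intro oriented_multigraph.intro oriented_multigraph_axioms.intro)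
  have closed: "closed_walk G p" if "circuit G arev p" for p
    using that by (simp add: circuit_def)
  have fin: "finite {p. closed_walk G p \<and> length p = l}"
    by (rule finite_subset[OF _ finite_lists_length_eq[OF finite_arcs, of l]])
      (auto simp: closed_walk_def awalk_def)
  then have fin': "finite {p. circuit G arev p \<and> length p = l}"
    by (rule rev_finite_subset) (auto simp: closed)
  \<comment> \<open>Both formulas are instances, for the circuits and for the closed walks of length
    \<open>l\<close>; dividing is possible because \<open>t\<close> is nonzero.\<close>
  have count: "of_nat (card {p \<in> P. reduce_chain pos t (abelianization arev pos p) = \<alpha>})
      = 1 / of_nat t ^ genus G arev *
        (\<Sum>\<gamma>\<in>M pos t (cotree pos T). eps t powi (- chain_inner pos (residue_ring (int t)) \<gamma> \<alpha>)
          * (\<Sum>p\<in>P. prod_list (map (chi arev pos t \<gamma>) p)))"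
    if "finite P" "\<And>p. p \<in> P \<Longrightarrow> closed_walk G p" for P
    using t by (simp add: sum_characters_closed_walks[OF t tree \<alpha> that])
  have "circuit_count G arev pos t \<alpha> l = card {p \<in> {p. circuit G arev p \<and> length p = l}.
      reduce_chain pos t (abelianization arev pos p) = \<alpha>}"
    by (simp add: circuit_count_def conj_assoc)
  moreover have "closed_walk_count G arev pos t \<alpha> l = card {p \<in> {p. closed_walk G p \<and> length p = l}.
      reduce_chain pos t (abelianization arev pos p) = \<alpha>}"
    by (simp add: closed_walk_count_def conj_assoc)
  ultimately show ?thesis
    using count[OF fin] count[OF fin'] closed
    by (simp add: mat_trace_A_mat_pow[OF vs l] mat_trace_W_mat_pow[OF as l])
qed

end
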